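(* Let $A\subset\mathbb{R}^m$ be finite and nonempty, $z^+\in\mathbb{R}^m$, $\rho$ a nonnegative weight density on $\Delta^{m-1}$, and let $Q_L=\{(\lambda^{(\ell)},w_\ell)\}_{\ell=1}^L$ be a quadrature rule on $\Delta^{m-1}$. Under the Gaussian achievement surrogate $Z_x(\lambda)\sim N(m_x(\lambda),s_x^2(\lambda))$, $s_x(\lambda)>0$, the quantity $$\widehat{\mathrm{ER2I}}_{A,L}(x)=\sum_{\ell=1}^Lw_\ell\,\mathrm{EI}\bigl(h_A(\lambda^{(\ell)});m_x(\lambda^{(\ell)}),s_x(\lambda^{(\ell)})\bigr)\,\rho(\lambda^{(\ell)})$$ is a quadrature approximation of exact integral ER2I: it is the value $Q_L[F_x]=\sum_\ell w_\ell F_x(\lambda^{(\ell)})$ of the rule $Q_L$ on the function $F_x(\lambda)=\mathbb{E}\bigl[(h_A(\lambda)-Z_x(\lambda))_+\bigr]\rho(\lambda)$, whose integral is $\mathrm{ER2I}_A(x)=\int_{\Delta^{m-1}}F_x(\lambda)\,d\sigma(\lambda)$.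
   Context: $\Delta^{m-1}=\{\lambda\in\mathbb{R}_+^m:\sum_i\lambda_i=1\}$ with surface (Lebesgue) measure $\sigma$; $\rho:\Delta^{m-1}\to[0,\infty)$ is integrable. $g_\lambda(y;z^+)=\max_i\lambda_i(y_i-z_i^+)$; $h_A(\lambda)=\min_{a\in A}g_\lambda(a;z^+)$; $(u)_+=\max\{u,0\}$. $\mathrm{EI}(c;\mu,s)=(c-\mu)\Phi\!\left(\frac{c-\mu}{s}\right)+s\,\varphi\!\left(\frac{c-\mu}{s}\right)$ with $\Phi,\varphi$ the standard normal distribution function and density. A quadrature rule $Q_L$ consists of nodes $\lambda^{(\ell)}\in\Delta^{m-1}$ and real weights $w_\ell$, and approximates $\int_{\Delta^{m-1}}F\,d\sigma$ by $\sum_\ell w_\ell F(\lambda^{(\ell)})$. Exact integral ER2I under the Gaussian achievement surrogate is $\mathrm{ER2I}_A(x)=\int_{\Delta^{m-1}}\mathbb{E}[(h_A(\lambda)-Z_x(\lambda))_+]\,\rho(\lambda)\,d\sigma(\lambda)$, with $m_x,s_x$ measurable in $\lambda$ and the integral taken in $[0,\infty]$. *)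

theory Defs
  imports "HOL-Probability.Probability"
begin

definition prob_simplex :: "(real ^ 'm::finite) set" where
  "prob_simplex = {lam. (\<forall>i. 0 \<le> lam $ i) \<and> (\<Sum>i\<in>UNIV. lam $ i) = 1}"

definition simplex_normal :: "real ^ 'm::finite" where
  "simplex_normal = (\<chi> i. 1 / sqrt (real CARD('m)))"

text \<open>
  The library has no surface measure, so the \<open>(m-1)\<close>-dimensional Lebesgue measure on the simplex is
  obtained from \<open>m\<close>-dimensional Lebesgue measure: the right prism of height 1 over a set \<open>B\<close> in the
  hyperplane of the simplex has volume \<open>1 * \<sigma> B\<close>.  Thus \<open>\<sigma>\<close> is the image of Lebesgue measure on the
  prism over the whole simplex under orthogonal projection onto that hyperplane (whose distance from
  the origin is \<open>1 / sqrt m\<close>); see \<open>emeasure_simplex_surface\<close>.  For \<open>m = 1\<close> it is the unit point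
  mass.  The completion makes the measurable sets the Lebesgue measurable ones.
\<close>

definition simplex_prism :: "(real ^ 'm::finite) set \<Rightarrow> (real ^ 'm) set" where
  "simplex_prism B = {b + t *\<^sub>R simplex_normal | b t. b \<in> B \<and> t \<in> {0..1}}"

definition simplex_proj :: "real ^ 'm::finite \<Rightarrow> real ^ 'm" where
  "simplex_proj y = y - (simplex_normal \<bullet> y - 1 / sqrt (real CARD('m))) *\<^sub>R simplex_normal"

definition simplex_surface :: "(real ^ 'm::finite) measure" where
  "simplex_surface = completion
     (distr (restrict_space lborel (simplex_prism prob_simplex))
            (restrict_space borel prob_simplex) simplex_proj)"

lemma space_simplex_surface [simp]: "space simplex_surface = prob_simplex"
  by (simp add: simplex_surface_def space_restrict_space)

lemma simplex_normal_inner_self: "simplex_normal \<bullet> (simplex_normal :: real ^ 'm::finite) = 1"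
  by (simp add: simplex_normal_def inner_vec_def)

lemma simplex_normal_inner:
  assumes "(b :: real ^ 'm::finite) \<in> prob_simplex"
  shows "simplex_normal \<bullet> b = 1 / sqrt (real CARD('m))"
  using assms
  by (simp add: simplex_normal_def inner_vec_def prob_simplex_def flip: sum_divide_distrib)

lemma simplex_proj_prism:
  assumes "(b :: real ^ 'm::finite) \<in> prob_simplex"
  shows "simplex_proj (b + t *\<^sub>R simplex_normal) = b"
  using assms
  by (simp add: simplex_proj_def inner_add_right simplex_normal_inner simplex_normal_inner_self)

lemma compact_prob_simplex: "compact (prob_simplex :: (real ^ 'm::finite) set)"
proof -
  have "closed (prob_simplex :: (real ^ 'm) set)"
    unfolding prob_simplex_def
    by (intro closed_Collect_conj closed_Collect_all closed_Collect_le closed_Collect_eq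
        continuous_intros)
  moreover have "norm b \<le> 1" if "b \<in> prob_simplex" for b :: "real ^ 'm"
    using norm_le_l1_cart[of b] that by (simp add: prob_simplex_def)
  then have "bounded (prob_simplex :: (real ^ 'm) set)"
    unfolding bounded_iff by blast
  ultimately show ?thesis by (simp add: compact_eq_bounded_closed)
qed

lemma simplex_prism_borel: "simplex_prism (prob_simplex :: (real ^ 'm::finite) set) \<in> sets borel"
proof -
  have eq: "simplex_prism (prob_simplex :: (real ^ 'm) set) =
      (\<lambda>(b, t). b + t *\<^sub>R simplex_normal) ` (prob_simplex \<times> {0..1})"
    by (force simp: simplex_prism_def image_iff)
  have "compact (simplex_prism (prob_simplex :: (real ^ 'm) set))"
    unfolding eq case_prod_beta
    by (intro compact_continuous_image compact_Times compact_prob_simplex continuous_intros) simp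
  then show ?thesis by (rule borel_compact)
qed

lemma simplex_proj_measurable:
  "(simplex_proj :: real ^ 'm::finite \<Rightarrow> _) \<in>
     restrict_space lborel (simplex_prism prob_simplex) \<rightarrow>\<^sub>M restrict_space borel prob_simplex"
proof (rule measurable_restrict_space2)
  show "simplex_proj \<in> space (restrict_space lborel (simplex_prism prob_simplex)) \<rightarrow> prob_simplex"
    by (auto simp: space_restrict_space simplex_prism_def simplex_proj_prism)
  have "continuous_on UNIV (simplex_proj :: real ^ 'm \<Rightarrow> _)"
    unfolding simplex_proj_def by (intro continuous_intros)
  then have "(simplex_proj :: real ^ 'm \<Rightarrow> _) \<in> borel_measurable borel"
    by (rule borel_measurable_continuous_onI)
  then show "(simplex_proj :: real ^ 'm \<Rightarrow> _) \<in>
      borel_measurable (restrict_space lborel (simplex_prism prob_simplex))"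
    by (intro measurable_restrict_space1) simp
qed

lemma emeasure_simplex_surface:
  assumes "B \<in> sets borel" "B \<subseteq> prob_simplex"
  shows "emeasure simplex_surface B = emeasure lborel (simplex_prism (B :: (real ^ 'm::finite) set))"
proof -
  let ?P = "simplex_prism prob_simplex :: (real ^ 'm) set"
  have B: "B \<in> sets (restrict_space borel prob_simplex)"
    using assms by (auto simp: sets_restrict_space)
  have pre: "simplex_proj -` B \<inter> ?P = simplex_prism B"
    using assms(2) by (force simp: simplex_prism_def simplex_proj_prism)
  have "emeasure simplex_surface B =
      emeasure (distr (restrict_space lborel ?P) (restrict_space borel prob_simplex) simplex_proj) B"
    unfolding simplex_surface_def using B by simp
  also have "\<dots> = emeasure (restrict_space lborel ?P) (simplex_prism B)"
    using B pre by (simp add: emeasure_distr[OF simplex_proj_measurable] space_restrict_space)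
  also have "\<dots> = emeasure lborel (simplex_prism B)"
    using pre simplex_prism_borel by (intro emeasure_restrict_space) auto
  finally show ?thesis .
qed

definition achievement :: "real ^ 'm::finite \<Rightarrow> real ^ 'm \<Rightarrow> real ^ 'm \<Rightarrow> real" where
  "achievement lam y z = Max (range (\<lambda>i. lam $ i * (y $ i - z $ i)))"

definition best_achievement :: "(real ^ 'm::finite) set \<Rightarrow> real ^ 'm \<Rightarrow> real ^ 'm \<Rightarrow> real" where
  "best_achievement A z lam = Min ((\<lambda>a. achievement lam a z) ` A)"

definition EI :: "real \<Rightarrow> real \<Rightarrow> real \<Rightarrow> real" where
  "EI c \<mu> s = (c - \<mu>) * cdf std_normal_distribution ((c - \<mu>) / s)
            + s * std_normal_density ((c - \<mu>) / s)"

text \<open>The nodes are \<open>\<xi> l\<close> and the weights \<open>w l\<close> for \<open>l = 1, \<dots>, L\<close>; the weights are arbitrary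
  reals, so they carry no condition.\<close>

definition quadrature_rule :: "nat \<Rightarrow> (nat \<Rightarrow> real ^ 'm::finite) \<Rightarrow> (nat \<Rightarrow> real) \<Rightarrow> bool" where
  "quadrature_rule L \<xi> w \<longleftrightarrow> (\<forall>l\<in>{1..L}. \<xi> l \<in> prob_simplex)"

definition quadrature ::
  "nat \<Rightarrow> (nat \<Rightarrow> real ^ 'm::finite) \<Rightarrow> (nat \<Rightarrow> real) \<Rightarrow> (real ^ 'm \<Rightarrow> real) \<Rightarrow> real" where
  "quadrature L \<xi> w F = (\<Sum>l=1..L. w l * F (\<xi> l))"

text \<open>In the following, \<open>Z lam\<close> is the surrogate \<open>Z\<^sub>x(lam)\<close> at one design point, a random variable
  on \<open>M\<close>.\<close>

definition ER2I_integrand ::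
  "'w measure \<Rightarrow> (real ^ 'm::finite \<Rightarrow> 'w \<Rightarrow> real) \<Rightarrow> (real ^ 'm) set \<Rightarrow> real ^ 'm \<Rightarrow>
   (real ^ 'm \<Rightarrow> real) \<Rightarrow> real ^ 'm \<Rightarrow> real" where
  "ER2I_integrand M Z A z \<rho> lam =
     (\<integral>\<omega>. max (best_achievement A z lam - Z lam \<omega>) 0 \<partial>M) * \<rho> lam"

text \<open>The exact criterion takes values in \<open>[0, \<infinity>]\<close>, so both the expectation and the outer integral
  are the extended nonnegative ones; no integrability is presupposed.\<close>

definition ER2I ::
  "'w measure \<Rightarrow> (real ^ 'm::finite \<Rightarrow> 'w \<Rightarrow> real) \<Rightarrow> (real ^ 'm) set \<Rightarrow> real ^ 'm \<Rightarrow>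
   (real ^ 'm \<Rightarrow> real) \<Rightarrow> ennreal" where
  "ER2I M Z A z \<rho> =
     (\<integral>\<^sup>+lam. (\<integral>\<^sup>+\<omega>. ennreal (max (best_achievement A z lam - Z lam \<omega>) 0) \<partial>M) * ennreal (\<rho> lam)
        \<partial>simplex_surface)"

definition ER2I_hat ::
  "nat \<Rightarrow> (nat \<Rightarrow> real ^ 'm::finite) \<Rightarrow> (nat \<Rightarrow> real) \<Rightarrow> (real ^ 'm) set \<Rightarrow> real ^ 'm \<Rightarrow>
   (real ^ 'm \<Rightarrow> real) \<Rightarrow> (real ^ 'm \<Rightarrow> real) \<Rightarrow> (real ^ 'm \<Rightarrow> real) \<Rightarrow> real" where
  "ER2I_hat L \<xi> w A z \<rho> m s =
     (\<Sum>l=1..L. w l * EI (best_achievement A z (\<xi> l)) (m (\<xi> l)) (s (\<xi> l)) * \<rho> (\<xi> l))"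

end

theory Submission
  imports Defs
begin

text \<open>
  The nodes of the rule lie in the simplex, so the first claim comes down to the closed form
  \<open>\<integral> max (c - Z) 0 \<partial>M = EI c \<mu> s\<close> for a normal variable \<open>Z\<close>
  (\<open>expected_improvement_normal\<close>).  Standardising \<open>Z\<close> leaves the integral of \<open>(u - t) \<phi>(t)\<close> over
  \<open>t < u\<close>, where \<open>u = (c - \<mu>) / s\<close>.  The term with factor \<open>u\<close> is \<open>u \<Phi>(u)\<close> by definition of the
  distribution function, and the other one is \<open>\<phi>(u)\<close>, because \<open>-\<phi>\<close> is an antiderivative of
  \<open>t \<phi>(t)\<close>.

  The closed form carries the rest as well.  It comes with integrability, so at every point of the
  simplex the extended expectation is the image of the real one, and the two ways of writing the
  exact criterion agree.  It also settles measurability of the integrand in \<open>lam\<close>: no joint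
  measurability of \<open>Z\<close> in \<open>(lam, \<omega>)\<close> is at hand, but the closed form depends on \<open>lam\<close> only through
  the measurable functions \<open>m\<close>, \<open>s\<close> and the minimum over \<open>A\<close>.
\<close>

text \<open>
  This is the fundamental theorem of calculus on \<open>(-\<infinity>, u)\<close>: the function \<open>-\<phi>\<close> has derivative
  \<open>t \<phi>(t)\<close> and vanishes at \<open>-\<infinity>\<close>.  The half-line is open because interval integrals run over
  open intervals.
\<close>

lemma std_normal_partial_first_moment:
  "has_bochner_integral lborel (\<lambda>t. indicator {..<u} t * (t * std_normal_density t))
     (- std_normal_density u)"
proof -
  let ?f = "\<lambda>t::real. t * std_normal_density t" and ?F = "\<lambda>t. - std_normal_density t"
  \<comment> \<open>An opaque factor keeps \<open>1 / sqrt (2 * pi)\<close> from being differentiated as a quotient.\<close>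
  obtain k where K: "std_normal_density = (\<lambda>t. k * exp (- t\<^sup>2 / 2))"
    using std_normal_density_def by blast
  have int: "integrable lborel ?f"
    using integrable_std_normal_moment[of 1] by (simp add: mult.commute)
  have si: "set_integrable lborel (einterval (-\<infinity>) (ereal u)) ?f"
    unfolding set_integrable_def using int by (intro integrable_mult_indicator) auto
  have "(LBINT t=-\<infinity>..ereal u. ?f t) = ?F u - 0"
  proof (rule interval_integral_FTC_integrable)
    fix t :: real
    show "(?F has_vector_derivative ?f t) (at t)"
      unfolding has_real_derivative_iff_has_vector_derivative[symmetric] K
      by (auto intro!: derivative_eq_intros)
    show "isCont ?f t"
      unfolding K by (intro continuous_intros) auto
    show "set_integrable lborel (einterval (-\<infinity>) (ereal u)) ?f" by (rule si)
    show "((?F \<circ> real_of_ereal) \<longlongrightarrow> 0) (at_right (-\<infinity>))"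
      unfolding ereal_tendsto_simps K by real_asymp
    have "isCont ?F u" unfolding K by (intro continuous_intros) auto
    then show "((?F \<circ> real_of_ereal) \<longlongrightarrow> ?F u) (at_left (ereal u))"
      unfolding ereal_tendsto_simps isCont_def by (rule filterlim_mono) (auto simp: at_within_le_at)
  qed auto
  moreover have "einterval (-\<infinity>) (ereal u) = {..<u}" by (auto simp: einterval_def)
  ultimately show ?thesis
    using si
    by (auto simp: has_bochner_integral_iff interval_lebesgue_integral_def
        set_lebesgue_integral_def set_integrable_def)
qed

lemma cdf_std_normal_has_bochner_integral:
  "has_bochner_integral lborel (\<lambda>t. indicator {..u} t * std_normal_density t)
     (cdf std_normal_distribution u)"
proof -
  have "integrable lborel (\<lambda>t. std_normal_density t * indicator {..u} t)"
    using integrable_mult_indicator[of "{..u}" lborel "std_normal_density"] by (simp add: mult.commute)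
  moreover have "cdf std_normal_distribution u = (LINT t|lborel. std_normal_density t * indicator {..u} t)"
  proof -
    have "cdf std_normal_distribution u = (LINT t|std_normal_distribution. indicator {..u} t)"
      by (simp add: cdf_def)
    also have "\<dots> = (LINT t|lborel. std_normal_density t * indicator {..u} t)"
      by (subst integral_density) auto
    finally show ?thesis .
  qed
  ultimately show ?thesis by (simp add: has_bochner_integral_iff mult.commute)
qed

lemma std_normal_expected_positive_part:
  "has_bochner_integral lborel (\<lambda>t. std_normal_density t * max (u - t) 0)
     (u * cdf std_normal_distribution u + std_normal_density u)"
proof -
  have "has_bochner_integral lborel
      (\<lambda>t. u * (indicator {..u} t * std_normal_density t) - indicator {..<u} t * (t * std_normal_density t))
      (u * cdf std_normal_distribution u - (- std_normal_density u))"
    by (intro has_bochner_integral_diff has_bochner_integral_mult_right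
        cdf_std_normal_has_bochner_integral std_normal_partial_first_moment)
  \<comment> \<open>The two indicators differ at \<open>u\<close>, so the integrands agree only off that point.\<close>
  moreover have "AE t in lborel. std_normal_density t * max (u - t) 0 =
      u * (indicator {..u} t * std_normal_density t) - indicator {..<u} t * (t * std_normal_density t)"
    using AE_lborel_singleton[of u]
    by eventually_elim (auto simp: indicator_def max_def algebra_simps)
  ultimately show ?thesis
    by (subst has_bochner_integral_cong_AE) auto
qed

text \<open>
  Since \<open>s > 0\<close>, the positive part scales: \<open>(c - Z)\<^sub>+ = s (u - (Z - \<mu>) / s)\<^sub>+\<close> with
  \<open>u = (c - \<mu>) / s\<close>, and \<open>(Z - \<mu>) / s\<close> is standard normal.
\<close>

lemma (in prob_space) expected_improvement_normal:
  assumes "0 < s" and "distributed M lborel Z (normal_density \<mu> s)"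
  shows "has_bochner_integral M (\<lambda>\<omega>. max (c - Z \<omega>) 0) (EI c \<mu> s)"
proof -
  let ?u = "(c - \<mu>) / s" and ?g = "\<lambda>t. max ((c - \<mu>) / s - t) 0"
  have D: "distributed M lborel (\<lambda>\<omega>. (Z \<omega> - \<mu>) / s) std_normal_density"
    using assms(2) unfolding normal_standard_normal_convert[OF assms(1)] .
  have "has_bochner_integral M (\<lambda>\<omega>. ?g ((Z \<omega> - \<mu>) / s))
      (?u * cdf std_normal_distribution ?u + std_normal_density ?u)"
    using std_normal_expected_positive_part[of ?u]
      distributed_integrable[OF D, of ?g] distributed_integral[OF D, of ?g]
    by (simp add: has_bochner_integral_iff)
  then have "has_bochner_integral M (\<lambda>\<omega>. s * ?g ((Z \<omega> - \<mu>) / s))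
      (s * (?u * cdf std_normal_distribution ?u + std_normal_density ?u))"
    by (rule has_bochner_integral_mult_right)
  moreover have "s * ?g ((Z \<omega> - \<mu>) / s) = max (c - Z \<omega>) 0" for \<omega>
    using assms(1) by (simp add: max_def field_simps)
  moreover have "s * (?u * cdf std_normal_distribution ?u + std_normal_density ?u) = EI c \<mu> s"
    using assms(1) by (simp add: EI_def distrib_left)
  ultimately show ?thesis by simp
qed

lemma borel_measurable_cdf_std_normal [measurable]:
  "cdf std_normal_distribution \<in> borel_measurable borel"
proof -
  interpret real_distribution std_normal_distribution by (rule real_dist_normal_dist)
  show ?thesis by (intro borel_measurable_mono monoI cdf_nondecreasing)
qed

lemma borel_measurable_EI [measurable (raw)]:
  assumes [measurable]: "c \<in> borel_measurable N" "\<mu> \<in> borel_measurable N" "s \<in> borel_measurable N"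
  shows "(\<lambda>x. EI (c x) (\<mu> x) (s x)) \<in> borel_measurable N"
  unfolding EI_def by measurable

text \<open>The surface measure is a completion, so it has at least the Borel sets of the simplex.\<close>

lemma borel_measurable_simplex_surface:
  assumes "f \<in> borel_measurable borel"
  shows "f \<in> borel_measurable (simplex_surface :: (real ^ 'm::finite) measure)"
  unfolding simplex_surface_def
  by (intro measurable_completion) (simp add: measurable_restrict_space1 assms)

lemma borel_measurable_best_achievement:
  assumes "finite A"
  shows "best_achievement A z \<in> borel_measurable borel"
  unfolding best_achievement_def achievement_def
  using assms by measurable

theorem theorem8p2:
  fixes A :: "(real ^ 'm::finite) set"
    and z :: "real ^ 'm"
    and \<rho> :: "real ^ 'm \<Rightarrow> real"
    and L :: nat
    and \<xi> :: "nat \<Rightarrow> real ^ 'm"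
    and w :: "nat \<Rightarrow> real"
    and M :: "'w measure"
    and Z :: "'x \<Rightarrow> real ^ 'm \<Rightarrow> 'w \<Rightarrow> real"
    and m s :: "'x \<Rightarrow> real ^ 'm \<Rightarrow> real"
    and x :: 'x
  assumes "finite A" and "A \<noteq> {}"
    and "\<And>lam. lam \<in> prob_simplex \<Longrightarrow> 0 \<le> \<rho> lam"
    and "integrable simplex_surface \<rho>"
    and "quadrature_rule L \<xi> w"
    and "prob_space M"
    and "m x \<in> borel_measurable simplex_surface"
    and "s x \<in> borel_measurable simplex_surface"
    and "\<And>lam. lam \<in> prob_simplex \<Longrightarrow> 0 < s x lam"
    and "\<And>lam. lam \<in> prob_simplex \<Longrightarrow>
           distributed M lborel (Z x lam) (normal_density (m x lam) (s x lam))"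
  shows "ER2I_hat L \<xi> w A z \<rho> (m x) (s x) = quadrature L \<xi> w (ER2I_integrand M (Z x) A z \<rho>)
    \<and> (\<forall>lam\<in>prob_simplex.
          integrable M (\<lambda>\<omega>. max (best_achievement A z lam - Z x lam \<omega>) 0)
          \<and> 0 \<le> ER2I_integrand M (Z x) A z \<rho> lam)
    \<and> ER2I_integrand M (Z x) A z \<rho> \<in> borel_measurable simplex_surface
    \<and> ER2I M (Z x) A z \<rho>
        = (\<integral>\<^sup>+lam. ennreal (ER2I_integrand M (Z x) A z \<rho> lam) \<partial>simplex_surface)"
proof (intro conjI ballI)
  let ?h = "best_achievement A z" and ?F = "ER2I_integrand M (Z x) A z \<rho>"
  have EI: "has_bochner_integral M (\<lambda>\<omega>. max (?h lam - Z x lam \<omega>) 0)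
      (EI (?h lam) (m x lam) (s x lam))" if "lam \<in> prob_simplex" for lam
    using that assms by (intro prob_space.expected_improvement_normal) auto
  have F: "?F lam = EI (?h lam) (m x lam) (s x lam) * \<rho> lam" if "lam \<in> prob_simplex" for lam
    using EI[OF that] by (simp add: ER2I_integrand_def has_bochner_integral_iff)
  show "ER2I_hat L \<xi> w A z \<rho> (m x) (s x) = quadrature L \<xi> w ?F"
    unfolding ER2I_hat_def quadrature_def
    using assms(5) by (intro sum.cong) (simp_all add: F quadrature_rule_def)
  show "integrable M (\<lambda>\<omega>. max (?h lam - Z x lam \<omega>) 0)" if "lam \<in> prob_simplex" for lam
    using EI[OF that] by (simp add: has_bochner_integral_iff)
  show "0 \<le> ?F lam" if "lam \<in> prob_simplex" for lam
    unfolding ER2I_integrand_def using assms(3)[OF that]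
    by (intro mult_nonneg_nonneg Bochner_Integration.integral_nonneg) auto
  have [measurable]: "?h \<in> borel_measurable simplex_surface"
    "m x \<in> borel_measurable simplex_surface" "s x \<in> borel_measurable simplex_surface"
    "\<rho> \<in> borel_measurable simplex_surface"
    using assms by (auto intro: borel_measurable_simplex_surface borel_measurable_best_achievement)
  have "(\<lambda>lam. EI (?h lam) (m x lam) (s x lam) * \<rho> lam) \<in> borel_measurable simplex_surface"
    by measurable
  then show "?F \<in> borel_measurable simplex_surface"
    by (rule measurable_cong[THEN iffD1, rotated]) (simp add: F)
  show "ER2I M (Z x) A z \<rho> = (\<integral>\<^sup>+lam. ennreal (?F lam) \<partial>simplex_surface)"
    unfolding ER2I_def
  proof (intro nn_integral_cong)
    fix lam :: "real ^ 'm" assume "lam \<in> space simplex_surface"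
    then have lam: "lam \<in> prob_simplex" by simp
    then have "(\<integral>\<^sup>+\<omega>. ennreal (max (?h lam - Z x lam \<omega>) 0) \<partial>M)
        = ennreal (\<integral>\<omega>. max (?h lam - Z x lam \<omega>) 0 \<partial>M)"
      using EI[OF lam] by (intro nn_integral_eq_integral) (auto simp: has_bochner_integral_iff)
    then show "(\<integral>\<^sup>+\<omega>. ennreal (max (?h lam - Z x lam \<omega>) 0) \<partial>M) * ennreal (\<rho> lam) = ennreal (?F lam)"
      using assms(3)[OF lam] by (simp add: ER2I_integrand_def ennreal_mult'')
  qed
qed

end
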